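(* For every real number $s>1$ there exist positive integers $a,b,c,d$ with $a\neq c$ and $\gcd(a,b)=\gcd(c,d)=1$ such that $\sigma_s(an+b)-\sigma_s(cn+d)$ changes sign infinitely often as $n$ ranges over the positive integers, i.e. $\sigma_s(an+b)-\sigma_s(cn+d)>0$ for infinitely many positive integers $n$ and $\sigma_s(an+b)-\sigma_s(cn+d)<0$ for infinitely many positive integers $n$.
   Context: For a real number $s$ and a positive integer $n$, $\sigma_s(n)=\sum_{d\mid n} d^s$, the sum over the positive divisors $d$ of $n$. *)

theory Defs
  imports Complex_Main
begin

(* Only meaningful for n > 0: the divisors of 0 form an infinite set, so the sum is then 0. *)
definition divisor_sigma :: "real \<Rightarrow> nat \<Rightarrow> real" where
  "divisor_sigma s n = (\<Sum>d | d dvd n. real d powr s)"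

end

theory Submission
  imports Defs "HOL-Analysis.Summation_Tests"
begin

text \<open>
  Write \<open>\<sigma>\<^sub>s(m) = m\<^sup>s \<Sum>\<^bsub>k | m\<^esub> k\<^sup>-\<^sup>s\<close>. Since the zeta series converges
  for \<open>s > 1\<close>, \<open>\<sigma>\<^sub>s(m) / m\<^sup>s\<close> is arbitrarily close to 1 once \<open>m\<close> has no small divisor
  other than 1. Take \<open>a\<close> odd and large, \<open>b = 2\<close>, \<open>c = a + 1\<close> and \<open>d = 1\<close>.
  If \<open>n\<close> is an even multiple of \<open>N!\<close>, then \<open>cn + 1\<close> has no small divisor while \<open>an + 2\<close> is even, and
  the resulting factor \<open>1 + 2\<^sup>-\<^sup>s\<close> outweighs \<open>(c/a)\<^sup>s\<close>, which is close to 1.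
  If \<open>n\<close> is odd and divisible by all odd numbers up to \<open>N\<close>, then \<open>an + 2\<close> has no small
  divisor, and \<open>c > a\<close> makes \<open>\<sigma>\<^sub>s(cn + 1)\<close> the larger value.
\<close>

text \<open>Pairing each divisor \<open>k\<close> with its complement \<open>m div k\<close> turns
  \<open>k powr s\<close> into \<open>m powr s * k powr (-s)\<close>.\<close>

lemma divisor_sigma_eq_inverse_sum:
  assumes "m > 0"
  shows "divisor_sigma s m = real m powr s * (\<Sum>k | k dvd m. real k powr (-s))"
proof -
  have "divisor_sigma s m = (\<Sum>k | k dvd m. real (m div k) powr s)"
    unfolding divisor_sigma_def using assms
    by (intro sum.reindex_bij_witness[of _ "\<lambda>k. m div k" "\<lambda>k. m div k"]) auto
  also have "\<dots> = (\<Sum>k | k dvd m. real m powr s * real k powr (-s))"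
    by (intro sum.cong) (auto simp: real_of_nat_div powr_divide powr_minus_divide)
  finally show ?thesis
    by (simp add: sum_distrib_left)
qed

lemma divisor_sigma_ge_powr:
  assumes "m > 0"
  shows "real m powr s \<le> divisor_sigma s m"
  unfolding divisor_sigma_def using assms
  by (intro member_le_sum) auto

lemma divisor_sigma_even_ge:
  assumes "m > 0" "even m"
  shows "real m powr s * (1 + 2 powr (-s)) \<le> divisor_sigma s m"
proof -
  have "(\<Sum>k\<in>{1, 2}. real k powr (-s)) \<le> (\<Sum>k | k dvd m. real k powr (-s))"
    using assms by (intro sum_mono2) auto
  then show ?thesis
    using assms by (simp add: divisor_sigma_eq_inverse_sum mult_left_mono)
qed

text \<open>Divisors of \<open>m\<close> other than 1 exceed \<open>N\<close>, so they contribute at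
  most a block of the convergent series of \<open>k powr (-s)\<close> starting at \<open>N\<close>.
  By the Cauchy criterion, a suitable \<open>N\<close> keeps every such block below
  \<open>e\<close>.\<close>

lemma divisor_sigma_le_if_no_small_divisors:
  fixes s e :: real
  assumes "s > 1" "e > 0"
  obtains N :: nat where
    "\<And>m. m > 0 \<Longrightarrow> (\<And>k. k dvd m \<Longrightarrow> k \<le> N \<Longrightarrow> k = 1) \<Longrightarrow>
       divisor_sigma s m \<le> real m powr s * (1 + e)"
proof -
  have "summable (\<lambda>k. real k powr (-s))"
    using assms by (simp add: summable_real_powr_iff)
  from summable_partial_sum_bound[OF this \<open>e > 0\<close>]
  obtain N where N: "\<And>m n. m \<ge> N \<Longrightarrow> norm (\<Sum>k=m..n. real k powr (-s)) < e"
    by metis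
  show thesis
  proof (rule that[of N])
    fix m :: nat
    assume m: "m > 0" and small: "\<And>k. k dvd m \<Longrightarrow> k \<le> N \<Longrightarrow> k = 1"
    have "{k. k dvd m} \<subseteq> insert 1 {N..m}"
      using small m by (force dest: dvd_imp_le)
    then have "(\<Sum>k | k dvd m. real k powr (-s)) \<le> (\<Sum>k\<in>insert 1 {N..m}. real k powr (-s))"
      by (intro sum_mono2) auto
    \<comment> \<open>Only an inequality, because 1 may already lie in \<open>{N..m}\<close> when
      \<open>N \<le> 1\<close>.\<close>
    also have "\<dots> \<le> 1 + (\<Sum>k=N..m. real k powr (-s))"
      by (subst sum.insert_if) (auto intro: sum_nonneg)
    also have "\<dots> \<le> 1 + e"
      using N[of N m] by simp
    finally show "divisor_sigma s m \<le> real m powr s * (1 + e)"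
      using m by (simp add: divisor_sigma_eq_inverse_sum mult_left_mono)
  qed
qed

lemma infinite_if_eventually_comp:
  fixes f :: "nat \<Rightarrow> nat"
  assumes "strict_mono f" "\<And>t. t \<ge> t0 \<Longrightarrow> P (f t)"
  shows "infinite {n. P n}"
proof -
  have "infinite (f ` {t0..})"
    using assms(1) by (simp add: finite_image_iff strict_mono_imp_inj_on infinite_Ici)
  moreover have "f ` {t0..} \<subseteq> {n. P n}"
    using assms(2) by auto
  ultimately show ?thesis
    using infinite_super by blast
qed

text \<open>The ratio tends to 1 as \<open>a\<close> grows. Oddness makes \<open>a\<close> coprime
  to \<open>b = 2\<close> and lets \<open>a * n + 2\<close> be odd for odd \<open>n\<close>.\<close>

lemma ex_odd_ratio_powr_gt:
  fixes s r :: real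
  assumes "r < 1"
  obtains a :: nat where "odd a" "(real a / real (a + 1)) powr s > r"
proof -
  have "(\<lambda>n. (1 - inverse (real (Suc n))) powr s) \<longlonglongrightarrow> (1 - 0) powr s"
    by (intro tendsto_intros LIMSEQ_inverse_real_of_nat) auto
  then have "eventually (\<lambda>n. (1 - inverse (real (Suc n))) powr s > r) sequentially"
    using assms by (intro order_tendstoD) auto
  then obtain n0 where n0: "\<And>n. n \<ge> n0 \<Longrightarrow> (1 - inverse (real (Suc n))) powr s > r"
    by (auto simp: eventually_sequentially)
  have "1 - inverse (real (Suc (2 * n0 + 1))) = real (2 * n0 + 1) / real (2 * n0 + 1 + 1)"
    by (simp add: field_simps)
  with n0[of "2 * n0 + 1"] show thesis
    by (intro that[of "2 * n0 + 1"]) auto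
qed

theorem theorem1:
  fixes s :: real
  assumes "s > 1"
  shows "\<exists>a b c d :: nat. a > 0 \<and> b > 0 \<and> c > 0 \<and> d > 0 \<and> a \<noteq> c \<and>
           gcd a b = 1 \<and> gcd c d = 1 \<and>
           infinite {n :: nat. n > 0 \<and> divisor_sigma s (a * n + b) - divisor_sigma s (c * n + d) > 0} \<and>
           infinite {n :: nat. n > 0 \<and> divisor_sigma s (a * n + b) - divisor_sigma s (c * n + d) < 0}"
proof -
  define h where "h = 1 + 2 powr (-s)"
  have "h > 1"
    by (simp add: h_def)
  then obtain a :: nat where a: "odd a" "(real a / real (a + 1)) powr s > 1 / h"
    by (auto intro: ex_odd_ratio_powr_gt[of "1 / h" s])
  then have "a > 0"
    by (auto intro: odd_pos)

  have "infinite {n. n > 0 \<and> divisor_sigma s (a * n + 2) - divisor_sigma s ((a + 1) * n + 1) > 0}"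
  proof -
    \<comment> \<open>Chosen so that \<open>1 + e\<close> absorbs the factor
      \<open>((a + 1) / a) powr s\<close> and leaves exactly \<open>h\<close>, the gain from the
      divisor 2.\<close>
    define e where "e = (real a / real (a + 1)) powr s * h - 1"
    have "e > 0"
      using a(2) \<open>h > 1\<close> by (simp add: e_def field_simps)
    then obtain N where N: "\<And>m. m > 0 \<Longrightarrow> (\<And>k. k dvd m \<Longrightarrow> k \<le> N \<Longrightarrow> k = 1) \<Longrightarrow>
        divisor_sigma s m \<le> real m powr s * (1 + e)"
      using divisor_sigma_le_if_no_small_divisors[OF assms] by metis
    show ?thesis
    proof (rule infinite_if_eventually_comp)
      show "strict_mono (\<lambda>t. 2 * fact N * t :: nat)"
        by (simp add: strict_mono_def)
    next
      fix t :: nat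
      assume "t \<ge> 1"
      define n :: nat where "n = 2 * fact N * t"
      have "n > 0" "even n"
        using \<open>t \<ge> 1\<close> by (auto simp: n_def)
      have small: "k = 1" if "k dvd (a + 1) * n + 1" "k \<le> N" for k
      proof -
        \<comment> \<open>Positivity together with \<open>k \<le> N\<close> makes \<open>k\<close> a
          divisor of \<open>fact N\<close>, hence of \<open>n\<close>, so that \<open>k\<close>
          divides 1.\<close>
        have "k > 0"
          using that(1) by (intro Nat.gr0I) auto
        then have "k dvd (a + 1) * n"
          using that(2) by (simp add: n_def dvd_fact)
        then show "k = 1"
          using that(1) by (metis dvd_add_right_iff nat_dvd_1_iff_1)
      qed
      have "divisor_sigma s ((a + 1) * n + 1) \<le> real ((a + 1) * n + 1) powr s * (1 + e)"
        by (rule N) (use small in auto)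
      also have "\<dots> = (real ((a + 1) * n + 1) * (real a / real (a + 1))) powr s * h"
        unfolding e_def by (subst powr_mult) auto
      also have "\<dots> < real (a * n + 2) powr s * h"
      proof -
        \<comment> \<open>The left side is \<open>a * n + a / (a + 1)\<close>.\<close>
        have "real ((a + 1) * n + 1) * (real a / real (a + 1)) < real (a * n + 2)"
          by (simp add: field_simps)
        then show ?thesis
          using \<open>h > 1\<close> assms by (intro mult_strict_right_mono powr_less_mono2) auto
      qed
      also have "\<dots> \<le> divisor_sigma s (a * n + 2)"
        unfolding h_def using \<open>even n\<close> by (intro divisor_sigma_even_ge) auto
      finally show "2 * fact N * t > 0 \<and> divisor_sigma s (a * (2 * fact N * t) + 2)
          - divisor_sigma s ((a + 1) * (2 * fact N * t) + 1) > 0"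
        using \<open>n > 0\<close> unfolding n_def by simp
    qed
  qed
  moreover
  have "infinite {n. n > 0 \<and> divisor_sigma s (a * n + 2) - divisor_sigma s ((a + 1) * n + 1) < 0}"
  proof -
    \<comment> \<open>The midpoint of 1 and \<open>(a + 1) / a\<close>: multiplying
      \<open>a * n\<close> by \<open>q\<close> adds only \<open>n / 2\<close>, which leaves
      \<open>n / 2\<close> to cover the constants.\<close>
    define q where "q = 1 + 1 / (2 * real a)"
    have "q > 1"
      using \<open>a > 0\<close> by (simp add: q_def)
    then have "q powr s - 1 > 0"
      using assms by (simp add: gr_one_powr)
    then obtain N where N: "\<And>m. m > 0 \<Longrightarrow> (\<And>k. k dvd m \<Longrightarrow> k \<le> N \<Longrightarrow> k = 1) \<Longrightarrow>
        divisor_sigma s m \<le> real m powr s * (1 + (q powr s - 1))"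
      using divisor_sigma_le_if_no_small_divisors[OF assms] by metis
    \<comment> \<open>An odd substitute for \<open>fact N\<close>, since \<open>n\<close> must now
      be odd.\<close>
    define M :: nat where "M = \<Prod>{k. odd k \<and> k \<le> N}"
    have "odd M"
      unfolding M_def by (auto simp: even_prod_iff)
    show ?thesis
    proof (rule infinite_if_eventually_comp)
      show "strict_mono (\<lambda>t. M * (2 * t + 1))"
        using \<open>odd M\<close> by (auto simp: strict_mono_def intro: odd_pos)
    next
      fix t :: nat
      assume "t \<ge> 2"
      define n where "n = M * (2 * t + 1)"
      have "odd n"
        using \<open>odd M\<close> by (simp add: n_def)
      \<comment> \<open>The final comparison \<open>n / 2 + 3 < n + 1\<close> needs
        \<open>n > 4\<close>, whence \<open>t \<ge> 2\<close>.\<close>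
      have "n \<ge> 1 * 5"
        unfolding n_def using \<open>odd M\<close> \<open>t \<ge> 2\<close> by (intro mult_le_mono) (auto simp: Suc_le_eq odd_pos)
      have small: "k = 1" if "k dvd a * n + 2" "k \<le> N" for k
      proof -
        \<comment> \<open>\<open>a * n + 2\<close> is odd, and so are its divisors. Then
          \<open>k\<close> divides \<open>M\<close>, hence \<open>n\<close>, and so 2.\<close>
        have "odd k"
          using that(1) \<open>odd a\<close> \<open>odd n\<close> by (metis dvd_trans even_add even_mult_iff even_numeral)
        then have "k dvd M"
          unfolding M_def using that(2) by (intro dvd_prodI) auto
        then have "k dvd 2"
          using that(1) by (metis dvd_add_right_iff dvd_mult dvd_mult2 n_def)
        then have "k \<le> 2"
          by (rule dvd_imp_le) simp
        with \<open>odd k\<close> show "k = 1"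
          by presburger
      qed
      have "divisor_sigma s (a * n + 2) \<le> real (a * n + 2) powr s * (1 + (q powr s - 1))"
        by (rule N) (use small in auto)
      also have "\<dots> = (real (a * n + 2) * q) powr s"
        using \<open>q > 1\<close> by (simp add: powr_mult)
      also have "\<dots> < real ((a + 1) * n + 1) powr s"
      proof -
        have "real (a * n + 2) * q = real a * real n + 2 + real n / 2 + 1 / real a"
          using \<open>a > 0\<close> by (simp add: q_def field_simps)
        also have "\<dots> \<le> real a * real n + 2 + real n / 2 + 1"
          using \<open>a > 0\<close> by simp
        also have "\<dots> < real ((a + 1) * n + 1)"
          using \<open>n \<ge> 1 * 5\<close> by (simp add: algebra_simps)
        finally show ?thesis
          using \<open>q > 1\<close> assms by (intro powr_less_mono2) auto
      qed
      also have "\<dots> \<le> divisor_sigma s ((a + 1) * n + 1)"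
        by (intro divisor_sigma_ge_powr) auto
      finally show "M * (2 * t + 1) > 0 \<and> divisor_sigma s (a * (M * (2 * t + 1)) + 2)
          - divisor_sigma s ((a + 1) * (M * (2 * t + 1)) + 1) < 0"
        using odd_pos[OF \<open>odd M\<close>] unfolding n_def by simp
    qed
  qed
  moreover have "gcd a 2 = 1"
    using \<open>odd a\<close> by simp
  ultimately show ?thesis
    using \<open>a > 0\<close>
    by (intro exI[of _ a] exI[of _ 2] exI[of _ "a + 1"] exI[of _ 1] conjI) auto
qed

end
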